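(* For $n\in\mathbb{N}$, the operator $L_nU_n$ is lower robust of order $n+1$, but upper robust only of order $2$.
   Context: For a bi-infinite real sequence $x=(x_i)_{i\in\mathbb{Z}}$ and $n\in\mathbb{N}$, with $\wedge=\min$, $\vee=\max$, $$(L_nx)_i=(x_{i-n}\wedge\cdots\wedge x_i)\vee(x_{i-n+1}\wedge\cdots\wedge x_{i+1})\vee\cdots\vee(x_i\wedge\cdots\wedge x_{i+n}),$$ $$(U_nx)_i=(x_{i-n}\vee\cdots\vee x_i)\wedge(x_{i-n+1}\vee\cdots\vee x_{i+1})\wedge\cdots\wedge(x_i\vee\cdots\vee x_{i+n}).$$ $L_nU_n$ is the composition in which $U_n$ is applied first and then $L_n$. An operator $S:\mathbb{R}^{\mathbb{Z}}\to\mathbb{R}^{\mathbb{Z}}$ of this kind is lower robust of order $r$ if there exists a constant $\alpha>0$ such that for every bi-infinite sequence $X$ of identically distributed (not necessarily independent) random variables $X_i$ ($i\in\mathbb{Z}$) there exists $t_0\in\mathbb{R}$ such that $P(X_i<t)<\varepsilon$ implies $P((SX)_i<t)<\alpha\varepsilon^r$ for all $t<t_0$ and $\varepsilon>0$. $S$ is upper robust of order $r$ if there exists a constant $\alpha>0$ such that for every bi-infinite sequence $X$ of identically distributed (not necessarily independent) random variables $X_i$ ($i\in\mathbb{Z}$) there exists $t_0\in\mathbb{R}$ such that $P(X_i>t)<\varepsilon$ implies $P((SX)_i>t)<\alpha\varepsilon^r$ for all $t>t_0$ and $\varepsilon>0$.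
   Formalization: The random variables X_i are assumed independent as well as identically distributed: without independence both positive claims fail (X_i = Y for all i, Y unbounded). Also n ≥ 1, and the constant α is stated per sample space type; the space of bi-infinite real sequences covers all joint laws. *)

theory Defs
  imports "HOL-Probability.Probability"
begin

definition LULU_L :: "nat \<Rightarrow> (int \<Rightarrow> real) \<Rightarrow> (int \<Rightarrow> real)" where
  "LULU_L n x i = (MAX k\<in>{i - int n..i}. MIN j\<in>{k..k + int n}. x j)"

definition LULU_U :: "nat \<Rightarrow> (int \<Rightarrow> real) \<Rightarrow> (int \<Rightarrow> real)" where
  "LULU_U n x i = (MIN k\<in>{i - int n..i}. MAX j\<in>{k..k + int n}. x j)"

text \<open>
  Independence is essential here. If it were dropped from the definitions below, the constant
  sequence \<open>X i = Y\<close> with \<open>Y\<close> unbounded below (above) would show that no operator fixing constant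
  sequences is lower (upper) robust of any order greater than 1.
\<close>

definition iid_sequence :: "'w measure \<Rightarrow> (int \<Rightarrow> 'w \<Rightarrow> real) \<Rightarrow> bool" where
  "iid_sequence M X \<longleftrightarrow>
     prob_space M \<and>
     prob_space.indep_vars M (\<lambda>_. borel) X UNIV \<and>
     (\<forall>i j. distr M borel (X i) = distr M borel (X j))"

text \<open>
  A formula cannot quantify over types, so the type of sample points is a parameter of the
  robustness predicates. Every sequence of real random variables can be realised, with the same
  joint law, on the sample type \<^typ>\<open>int \<Rightarrow> real\<close>; on a finite type, such as
  \<^typ>\<open>unit\<close>, robustness of every order holds trivially. Hence positive claims should be made for
  an arbitrary sample type and negative ones for \<^typ>\<open>int \<Rightarrow> real\<close>.

  The events are meaningful only for operators that preserve measurability, as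
  \<^const>\<open>LULU_L\<close> and \<^const>\<open>LULU_U\<close> do: \<^const>\<open>measure\<close> is 0 on non-measurable sets.
\<close>

definition lower_robust ::
    "'w itself \<Rightarrow> ((int \<Rightarrow> real) \<Rightarrow> (int \<Rightarrow> real)) \<Rightarrow> real \<Rightarrow> bool" where
  "lower_robust _ S r \<longleftrightarrow>
     (\<exists>\<alpha>>0. \<forall>(M :: 'w measure) X. iid_sequence M X \<longrightarrow>
        (\<exists>t0. \<forall>t<t0. \<forall>\<epsilon>>0. \<forall>i.
           measure M {\<omega> \<in> space M. X i \<omega> < t} < \<epsilon> \<longrightarrow>
           measure M {\<omega> \<in> space M. S (\<lambda>j. X j \<omega>) i < t} < \<alpha> * \<epsilon> powr r))"

definition upper_robust ::
    "'w itself \<Rightarrow> ((int \<Rightarrow> real) \<Rightarrow> (int \<Rightarrow> real)) \<Rightarrow> real \<Rightarrow> bool" where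
  "upper_robust _ S r \<longleftrightarrow>
     (\<exists>\<alpha>>0. \<forall>(M :: 'w measure) X. iid_sequence M X \<longrightarrow>
        (\<exists>t0. \<forall>t>t0. \<forall>\<epsilon>>0. \<forall>i.
           measure M {\<omega> \<in> space M. X i \<omega> > t} < \<epsilon> \<longrightarrow>
           measure M {\<omega> \<in> space M. S (\<lambda>j. X j \<omega>) i > t} < \<alpha> * \<epsilon> powr r))"

end

theory Submission
  imports Defs
begin

text \<open>
  Comparing a minimum or maximum with a threshold \<open>t\<close> turns the operators into quantifiers over
  windows of \<open>n + 1\<close> consecutive indices, so both tails become questions about the random set of
  indices at which \<open>X\<close> lies beyond \<open>t\<close>. By independence, \<open>m\<close> prescribed indices lie in that set
  with probability \<open>p ^ m\<close>, where \<open>p\<close> is the tail probability of a single variable.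

  A low output requires a value of \<open>LULU_U n X\<close> near \<open>i\<close> that is low, and this requires a whole
  window of \<open>n + 1\<close> low inputs. Only \<open>2 * n + 1\<close> windows qualify, and the union bound gives the
  order \<open>n + 1\<close> (\<open>LU_less_imp\<close> and \<open>iid_union_bound\<close>).

  A high output requires \<open>n + 1\<close> consecutive high values of \<open>LULU_U n X\<close>, so that each of \<open>2 * n + 1\<close>
  overlapping windows meets the set of high inputs. Two of these windows are adjacent and hence
  disjoint (this needs \<open>n \<ge> 1\<close>), so two different inputs are high, which gives order 2
  (\<open>LU_greater_imp\<close>). Two suffice: every one of the windows contains \<open>k\<close> or \<open>k + n\<close>
  (\<open>LU_greaterI\<close>). Hence the upper tail of the output is at least \<open>p ^ 2\<close>, and no order above 2 is
  possible as soon as \<open>p\<close> is positive and tends to 0. Independent exponential variables show this.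
\<close>

section \<open>Level sets of the operators\<close>

lemma LULU_L_greater_iff:
  "t < LULU_L n x i \<longleftrightarrow> (\<exists>k\<in>{i - int n..i}. \<forall>j\<in>{k..k + int n}. t < x j)"
  unfolding LULU_L_def by (subst Max_gr_iff) auto

lemma LULU_U_greater_iff:
  "t < LULU_U n x i \<longleftrightarrow> (\<forall>k\<in>{i - int n..i}. \<exists>j\<in>{k..k + int n}. t < x j)"
  unfolding LULU_U_def by (subst Min_gr_iff) (auto simp: Max_gr_iff)

lemma LULU_L_less_iff:
  "LULU_L n x i < t \<longleftrightarrow> (\<forall>k\<in>{i - int n..i}. \<exists>j\<in>{k..k + int n}. x j < t)"
  unfolding LULU_L_def by (subst Max_less_iff) (auto simp: Min_less_iff)

lemma LULU_U_less_iff: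
  "LULU_U n x i < t \<longleftrightarrow> (\<exists>k\<in>{i - int n..i}. \<forall>j\<in>{k..k + int n}. x j < t)"
  unfolding LULU_U_def by (subst Min_less_iff) auto

lemma LU_less_imp:
  assumes "LULU_L n (LULU_U n x) i < t"
  shows "\<exists>k\<in>{i - int n..i + int n}. \<forall>j\<in>{k..k + int n}. x j < t"
proof -
  obtain m where m: "m \<in> {i..i + int n}" "LULU_U n x m < t"
    using assms unfolding LULU_L_less_iff by force
  then obtain k where "k \<in> {m - int n..m}" "\<forall>j\<in>{k..k + int n}. x j < t"
    unfolding LULU_U_less_iff by blast
  with m show ?thesis by force
qed

lemma LU_greater_imp:
  assumes "n \<ge> 1" "t < LULU_L n (LULU_U n x) i"
  shows "\<exists>k\<in>{i - int n..i}. \<exists>a\<in>{k - int n..k}. \<exists>b\<in>{k + 1..k + 1 + int n}. t < x a \<and> t < x b"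
proof -
  obtain k where k: "k \<in> {i - int n..i}" "\<forall>j\<in>{k..k + int n}. t < LULU_U n x j"
    using assms(2) unfolding LULU_L_greater_iff by blast
  have "\<exists>a\<in>{k - int n..k}. t < x a"
    using k(2)[rule_format, of k] unfolding LULU_U_greater_iff
    by (force dest: bspec[of _ _ "k - int n"])
  \<comment> \<open>The adjacent window lies in the range of some \<open>LULU_U n x j\<close> only because \<open>k + 1 \<le> k + n\<close>.\<close>
  moreover have "\<exists>b\<in>{k + 1..k + 1 + int n}. t < x b"
    using k(2)[rule_format, of "k + 1"] \<open>n \<ge> 1\<close> unfolding LULU_U_greater_iff
    by (force dest: bspec[of _ _ "k + 1"])
  ultimately show ?thesis using k(1) by blast
qed

lemma LU_greaterI:
  assumes "t < x k" "t < x (k + int n)"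
  shows "t < LULU_L n (LULU_U n x) k"
proof -
  have "\<exists>j\<in>{m..m + int n}. t < x j" if "i \<in> {k..k + int n}" "m \<in> {i - int n..i}" for i m
  proof (cases "m \<le> k")
    case True
    then show ?thesis using assms(1) that by (intro bexI[of _ k]) auto
  next
    case False
    then show ?thesis using assms(2) that by (intro bexI[of _ "k + int n"]) auto
  qed
  then show ?thesis
    unfolding LULU_L_greater_iff LULU_U_greater_iff by (intro bexI[of _ k]) auto
qed

lemma borel_measurable_LU:
  assumes [measurable]: "\<And>i. X i \<in> borel_measurable M"
  shows "(\<lambda>\<omega>. LULU_L n (LULU_U n (\<lambda>j. X j \<omega>)) i) \<in> borel_measurable M"
proof -
  have [measurable]: "(\<lambda>\<omega>. LULU_U n (\<lambda>j. X j \<omega>) i) \<in> borel_measurable M" for i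
    unfolding LULU_U_def by (intro borel_measurable_Min borel_measurable_Max) auto
  show ?thesis
    unfolding LULU_L_def by (intro borel_measurable_Min borel_measurable_Max) auto
qed

section \<open>Independent identically distributed sequences\<close>

lemma iid_measurable:
  assumes "iid_sequence M X"
  shows "X i \<in> borel_measurable M"
proof -
  interpret prob_space M using assms by (simp add: iid_sequence_def)
  show ?thesis using assms by (auto simp: iid_sequence_def indep_vars_def)
qed

lemma iid_prob_all:
  assumes iid: "iid_sequence M X" and J: "finite J" and A: "A \<in> sets borel"
  shows "measure M {\<omega>\<in>space M. \<forall>j\<in>J. X j \<omega> \<in> A} = measure M {\<omega>\<in>space M. X i \<omega> \<in> A} ^ card J"
proof (cases "J = {}")
  case True
  then show ?thesis using iid by (simp add: iid_sequence_def prob_space.prob_space)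
next
  case False
  interpret prob_space M using iid by (simp add: iid_sequence_def)
  have marginal: "prob (X j -` A \<inter> space M) = prob {\<omega>\<in>space M. X i \<omega> \<in> A}" for j
  proof -
    have "prob (X j -` A \<inter> space M) = measure (distr M borel (X j)) A"
      using A by (simp add: measure_distr iid_measurable[OF iid])
    also have "distr M borel (X j) = distr M borel (X i)"
      using iid by (auto simp: iid_sequence_def)
    also have "measure \<dots> A = prob (X i -` A \<inter> space M)"
      using A by (simp add: measure_distr iid_measurable[OF iid])
    also have "X i -` A \<inter> space M = {\<omega>\<in>space M. X i \<omega> \<in> A}" by auto
    finally show ?thesis .
  qed
  have "{\<omega>\<in>space M. \<forall>j\<in>J. X j \<omega> \<in> A} = (\<Inter>j\<in>J. X j -` A \<inter> space M)"
    using False by auto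
  also have "prob \<dots> = (\<Prod>j\<in>J. prob (X j -` A \<inter> space M))"
    using iid False J A by (intro indep_varsD[where I = UNIV]) (auto simp: iid_sequence_def)
  also have "\<dots> = prob {\<omega>\<in>space M. X i \<omega> \<in> A} ^ card J"
    by (simp add: marginal)
  finally show ?thesis .
qed

lemma iid_union_bound:
  assumes iid: "iid_sequence M X" and A: "A \<in> sets borel" and S: "finite S"
    and J: "\<And>s. s \<in> S \<Longrightarrow> finite (J s) \<and> card (J s) = m"
    and E: "\<And>\<omega>. \<omega> \<in> E \<Longrightarrow> \<omega> \<in> space M \<and> (\<exists>s\<in>S. \<forall>j\<in>J s. X j \<omega> \<in> A)"
  shows "measure M E \<le> real (card S) * measure M {\<omega>\<in>space M. X i \<omega> \<in> A} ^ m"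
proof -
  interpret prob_space M using iid by (simp add: iid_sequence_def)
  note [measurable] = iid_measurable[OF iid] A
  have meas: "{\<omega>\<in>space M. \<forall>j\<in>J s. X j \<omega> \<in> A} \<in> events" if "s \<in> S" for s
    using J[OF that] by (intro sets.sets_Collect_finite_All) auto
  have "prob E \<le> prob (\<Union>s\<in>S. {\<omega>\<in>space M. \<forall>j\<in>J s. X j \<omega> \<in> A})"
    using E meas S by (intro finite_measure_mono) auto
  also have "\<dots> \<le> (\<Sum>s\<in>S. prob {\<omega>\<in>space M. \<forall>j\<in>J s. X j \<omega> \<in> A})"
    using meas S by (intro measure_UNION_le) auto
  also have "\<dots> = (\<Sum>s\<in>S. prob {\<omega>\<in>space M. X i \<omega> \<in> A} ^ m)"
    using J iid_prob_all[OF iid _ A, of _ i] by (intro sum.cong) auto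
  finally show ?thesis by simp
qed

lemma exponential_iid_sequence:
  obtains M :: "(int \<Rightarrow> real) measure" and X where "iid_sequence M X"
    and "\<And>i t. 0 \<le> t \<Longrightarrow> measure M {\<omega>\<in>space M. t < X i \<omega>} = exp (- t)"
proof -
  define D :: "real measure" where "D = density lborel (exponential_density 1)"
  define M where "M = PiM (UNIV :: int set) (\<lambda>_. D)"
  define X where "X = (\<lambda>(i :: int) (\<omega> :: int \<Rightarrow> real). \<omega> i)"
  interpret D: prob_space D
    unfolding D_def by (rule prob_space_exponential_density) simp
  interpret M: prob_space M
    unfolding M_def by (rule prob_space_PiM) (rule D.prob_space_axioms)
  have sets_D [measurable_cong, simp]: "sets D = sets borel" by (simp add: D_def)
  have X [measurable]: "X i \<in> borel_measurable M" for i
    unfolding X_def M_def by measurable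
  have distr_X: "distr M borel (X i) = D" for i
  proof -
    have "distr M borel (X i) = distr M D (X i)" by (intro distr_cong) auto
    also have "\<dots> = D"
      unfolding M_def X_def by (intro distr_PiM_component) (auto intro: D.prob_space_axioms)
    finally show ?thesis .
  qed
  have "M.indep_vars (\<lambda>_. borel) X UNIV"
  proof (subst M.indep_vars_iff_distr_eq_PiM)
    have "distr M (PiM UNIV (\<lambda>_. borel)) (\<lambda>\<omega>. \<lambda>i\<in>UNIV. X i \<omega>) = distr M M (\<lambda>\<omega>. \<omega>)"
      unfolding M_def X_def by (intro distr_cong sets_PiM_cong) auto
    also have "\<dots> = M" by (rule distr_id)
    also have "\<dots> = PiM UNIV (\<lambda>i. distr M borel (X i))"
      unfolding distr_X by (simp add: M_def)
    finally show "distr M (PiM UNIV (\<lambda>_. borel)) (\<lambda>\<omega>. \<lambda>i\<in>UNIV. X i \<omega>) =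
      PiM UNIV (\<lambda>i. distr M borel (X i))" .
  qed auto
  then have iid: "iid_sequence M X"
    using M.prob_space_axioms by (simp add: iid_sequence_def distr_X)
  have "distr M lborel (X i) = D" for i
    using distr_X[of i] by (metis distr_cong sets_lborel)
  then have "distributed M lborel (X i) (exponential_density 1)" for i
    by (simp add: distributed_def D_def)
  then have "measure M {\<omega>\<in>space M. t < X i \<omega>} = exp (- t)" if "0 \<le> t" for i t
    using M.exponential_distributedD_gt[of "X i" 1 t] that by simp
  with iid show ?thesis by (rule that)
qed

section \<open>The orders of robustness\<close>

lemma lower_robust_LU: "lower_robust TYPE('w) (LULU_L n \<circ> LULU_U n) (real (n + 1))"
  unfolding lower_robust_def
proof (intro exI[of _ "real (2 * n + 1)"] conjI allI impI exI[of _ 0])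
  fix M :: "'w measure" and X and t \<epsilon> :: real and i
  assume iid: "iid_sequence M X" and "\<epsilon> > 0"
    and p: "measure M {\<omega> \<in> space M. X i \<omega> < t} < \<epsilon>"
  have "measure M {\<omega> \<in> space M. (LULU_L n \<circ> LULU_U n) (\<lambda>j. X j \<omega>) i < t}
      \<le> real (card {i - int n..i + int n}) * measure M {\<omega>\<in>space M. X i \<omega> \<in> {..<t}} ^ (n + 1)"
    by (rule iid_union_bound[OF iid, where J = "\<lambda>k. {k..k + int n}"])
      (auto dest!: LU_less_imp)
  also have "card {i - int n..i + int n} = 2 * n + 1" by simp
  also have "real (2 * n + 1) * measure M {\<omega>\<in>space M. X i \<omega> \<in> {..<t}} ^ (n + 1)
      < real (2 * n + 1) * \<epsilon> ^ (n + 1)"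
    using p by (intro mult_strict_left_mono power_strict_mono) auto
  also have "\<epsilon> ^ (n + 1) = \<epsilon> powr real (n + 1)"
    using \<open>\<epsilon> > 0\<close> by (rule powr_realpow[symmetric])
  finally show "measure M {\<omega> \<in> space M. (LULU_L n \<circ> LULU_U n) (\<lambda>j. X j \<omega>) i < t}
      < real (2 * n + 1) * \<epsilon> powr real (n + 1)" .
qed simp

lemma upper_robust_LU:
  assumes "n \<ge> 1"
  shows "upper_robust TYPE('w) (LULU_L n \<circ> LULU_U n) 2"
  unfolding upper_robust_def
proof (intro exI[of _ "real ((n + 1) ^ 3)"] conjI allI impI exI[of _ 0])
  fix M :: "'w measure" and X and t \<epsilon> :: real and i
  assume iid: "iid_sequence M X" and "\<epsilon> > 0"
    and p: "measure M {\<omega> \<in> space M. X i \<omega> > t} < \<epsilon>"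
  define S where "S = (SIGMA k:{i - int n..i}. {k - int n..k} \<times> {k + 1..k + 1 + int n})"
  have card_S: "card S = (n + 1) ^ 3"
    by (simp add: S_def power3_eq_cube algebra_simps nat_add_distrib)
  have "measure M {\<omega> \<in> space M. (LULU_L n \<circ> LULU_U n) (\<lambda>j. X j \<omega>) i > t}
      \<le> real (card S) * measure M {\<omega>\<in>space M. X i \<omega> \<in> {t<..}} ^ 2"
  proof (rule iid_union_bound[OF iid, where J = "\<lambda>(k, a, b). {a, b}"])
    fix \<omega> assume "\<omega> \<in> {\<omega> \<in> space M. (LULU_L n \<circ> LULU_U n) (\<lambda>j. X j \<omega>) i > t}"
    then have "\<omega> \<in> space M" and high: "t < LULU_L n (LULU_U n (\<lambda>j. X j \<omega>)) i" by auto
    obtain k a b where "(k, a, b) \<in> S" "t < X a \<omega>" "t < X b \<omega>"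
      using LU_greater_imp[OF assms high] unfolding S_def by blast
    with \<open>\<omega> \<in> space M\<close>
    show "\<omega> \<in> space M \<and> (\<exists>s\<in>S. \<forall>j\<in>(case s of (k, a, b) \<Rightarrow> {a, b}). X j \<omega> \<in> {t<..})"
      by (auto intro!: bexI[of _ "(k, a, b)"])
  qed (auto simp: S_def card_insert_if)
  also have "\<dots> < real (card S) * \<epsilon> ^ 2"
    using p by (intro mult_strict_left_mono power_strict_mono) (auto simp: card_S)
  also have "\<epsilon> ^ 2 = \<epsilon> powr 2"
    using \<open>\<epsilon> > 0\<close> by (simp add: powr_numeral)
  finally show "measure M {\<omega> \<in> space M. (LULU_L n \<circ> LULU_U n) (\<lambda>j. X j \<omega>) i > t}
      < real ((n + 1) ^ 3) * \<epsilon> powr 2"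
    by (simp only: card_S)
qed simp

lemma iid_LU_greater_ge:
  assumes iid: "iid_sequence M X" and "n \<ge> 1"
  shows "measure M {\<omega> \<in> space M. X i \<omega> > t} ^ 2
    \<le> measure M {\<omega> \<in> space M. LULU_L n (LULU_U n (\<lambda>j. X j \<omega>)) i > t}"
proof -
  interpret prob_space M using iid by (simp add: iid_sequence_def)
  note [measurable] = borel_measurable_LU[OF iid_measurable[OF iid]]
  have "prob {\<omega> \<in> space M. X i \<omega> > t} ^ 2 = prob {\<omega>\<in>space M. \<forall>j\<in>{i, i + int n}. X j \<omega> \<in> {t<..}}"
    using iid_prob_all[OF iid, of "{i, i + int n}" "{t<..}" i] \<open>n \<ge> 1\<close>
    by (simp add: power2_eq_square)
  also have "\<dots> \<le> prob {\<omega> \<in> space M. LULU_L n (LULU_U n (\<lambda>j. X j \<omega>)) i > t}"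
    by (intro finite_measure_mono) (auto intro!: LU_greaterI)
  finally show ?thesis .
qed

lemma not_upper_robust_LU:
  assumes "n \<ge> 1" "r > 2"
  shows "\<not> upper_robust TYPE(int \<Rightarrow> real) (LULU_L n \<circ> LULU_U n) r"
proof
  assume "upper_robust TYPE(int \<Rightarrow> real) (LULU_L n \<circ> LULU_U n) r"
  then obtain \<alpha> where "\<alpha> > 0" and \<alpha>: "\<And>(M :: (int \<Rightarrow> real) measure) X. iid_sequence M X \<Longrightarrow>
      \<exists>t0. \<forall>t>t0. \<forall>\<epsilon>>0. \<forall>i. measure M {\<omega> \<in> space M. X i \<omega> > t} < \<epsilon> \<longrightarrow>
        measure M {\<omega> \<in> space M. (LULU_L n \<circ> LULU_U n) (\<lambda>j. X j \<omega>) i > t} < \<alpha> * \<epsilon> powr r"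
    unfolding upper_robust_def by blast
  obtain M :: "(int \<Rightarrow> real) measure" and X where iid: "iid_sequence M X"
    and tail: "\<And>i t. 0 \<le> t \<Longrightarrow> measure M {\<omega>\<in>space M. t < X i \<omega>} = exp (- t)"
    by (rule exponential_iid_sequence) blast
  obtain t0 where t0: "\<And>t \<epsilon> i. t > t0 \<Longrightarrow> \<epsilon> > 0 \<Longrightarrow>
      measure M {\<omega> \<in> space M. X i \<omega> > t} < \<epsilon> \<Longrightarrow>
      measure M {\<omega> \<in> space M. (LULU_L n \<circ> LULU_U n) (\<lambda>j. X j \<omega>) i > t} < \<alpha> * \<epsilon> powr r"
    using \<alpha>[OF iid] by blast
  \<comment> \<open>The last entry of the maximum is where \<open>exp (- t) ^ 2\<close> overtakes
    \<open>\<alpha> * (2 * exp (- t)) powr r\<close>.\<close>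
  define t where "t = max (max 0 (t0 + 1)) (ln (\<alpha> * 2 powr r) / (r - 2))"
  have t: "t > t0" "t \<ge> 0" "ln (\<alpha> * 2 powr r) / (r - 2) \<le> t"
    by (auto simp: t_def)
  have "exp (- t) ^ 2 \<le> measure M {\<omega> \<in> space M. LULU_L n (LULU_U n (\<lambda>j. X j \<omega>)) 0 > t}"
    using iid_LU_greater_ge[OF iid \<open>n \<ge> 1\<close>, where i = 0 and t = t] tail[OF t(2)] by simp
  \<comment> \<open>The definition asks for a strict bound \<open>\<epsilon>\<close> on the input tail, hence the factor 2.\<close>
  also have "\<dots> < \<alpha> * (2 * exp (- t)) powr r"
    using t0[OF t(1), of "2 * exp (- t)" 0] tail[OF t(2)] by simp
  also have "\<dots> = (\<alpha> * 2 powr r) * exp (- (r * t))"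
    by (simp add: powr_mult) (simp add: powr_def)
  finally have "exp (- t) ^ 2 * exp (r * t) < (\<alpha> * 2 powr r) * exp (- (r * t)) * exp (r * t)"
    by (intro mult_strict_right_mono) auto
  also have "exp (- t) ^ 2 * exp (r * t) = exp ((r - 2) * t)"
    by (simp add: power2_eq_square algebra_simps flip: exp_add)
  also have "(\<alpha> * 2 powr r) * exp (- (r * t)) * exp (r * t) = \<alpha> * 2 powr r"
    by (simp add: exp_minus)
  finally have "exp ((r - 2) * t) < \<alpha> * 2 powr r" .
  then have "(r - 2) * t < ln (\<alpha> * 2 powr r)"
    using \<open>\<alpha> > 0\<close> by (subst exp_less_cancel_iff[symmetric]) simp
  with t(3) \<open>r > 2\<close> show False by (simp add: field_simps)
qed

theorem mainTheorem3:
  fixes n :: nat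
  assumes "n \<ge> 1"
  shows "lower_robust TYPE('w) (LULU_L n \<circ> LULU_U n) (real (n + 1)) \<and>
         upper_robust TYPE('w) (LULU_L n \<circ> LULU_U n) 2 \<and>
         (\<forall>r>2. \<not> upper_robust TYPE(int \<Rightarrow> real) (LULU_L n \<circ> LULU_U n) r)"
  using lower_robust_LU upper_robust_LU[OF assms] not_upper_robust_LU[OF assms] by blast

end
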